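(* Let $\mathbb{F}$ be an algebraically closed field of characteristic $p\ge 0$ and let $A$ be an infinite (countable) dimensional simple locally finite associative algebra over $\mathbb{F}$. Then $A$ possesses a perfect local system.
   Context: Algebras are associative and not required to have an identity element; ideals are two-sided. An algebra $A$ over $\mathbb{F}$ is locally finite if every finite set of elements of $A$ is contained in a finite dimensional subalgebra of $A$. A local system for $A$ is a system $\{A_\alpha\}_{\alpha\in\Gamma}$ of finite dimensional subalgebras of $A$ such that $A=\bigcup_{\alpha\in\Gamma}A_\alpha$ and for all $\alpha,\beta\in\Gamma$ there is $\gamma\in\Gamma$ with $A_\alpha,A_\beta\subseteq A_\gamma$. An algebra $B$ is perfect if $BB=B$, where $BB$ is the linear span of all products of two elements of $B$. A local system is perfect if each of its members is a perfect algebra. *)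

theory Defs
  imports
    "HOL-Computational_Algebra.Polynomial"
    "HOL-Library.Countable_Set"
begin

text \<open>
  An associative algebra over a field, not necessarily unital. The algebra is a whole type;
  class \<open>ring\<close> has an associative multiplication and no unit element.
\<close>

locale assoc_algebra = vector_space scale
  for scale :: "'k::field \<Rightarrow> 'a::ring \<Rightarrow> 'a" +
  assumes scale_mult_left: "scale c x * y = scale c (x * y)"
    and scale_mult_right: "x * scale c y = scale c (x * y)"
begin

definition finite_dim :: "'a set \<Rightarrow> bool" where
  "finite_dim S \<longleftrightarrow> (\<exists>B. finite B \<and> S = span B)"

definition countably_infinite_dim :: "'a set \<Rightarrow> bool" where
  "countably_infinite_dim S \<longleftrightarrow>
     (\<exists>B. independent B \<and> span B = S \<and> infinite B \<and> countable B)"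

definition subalgebra :: "'a set \<Rightarrow> bool" where
  "subalgebra S \<longleftrightarrow> subspace S \<and> (\<forall>x\<in>S. \<forall>y\<in>S. x * y \<in> S)"

definition ideal :: "'a set \<Rightarrow> bool" where
  "ideal I \<longleftrightarrow> subspace I \<and> (\<forall>x\<in>I. \<forall>a. a * x \<in> I \<and> x * a \<in> I)"

text \<open>
  The first conjunct is the usual convention \<open>AA \<noteq> 0\<close>; it excludes only the zero algebra and
  the one-dimensional algebra with zero multiplication.
\<close>

definition simple_algebra :: bool where
  "simple_algebra \<longleftrightarrow> (\<exists>x y :: 'a. x * y \<noteq> 0) \<and> (\<forall>I. ideal I \<longrightarrow> I = {0} \<or> I = UNIV)"

definition locally_finite_algebra :: bool where
  "locally_finite_algebra \<longleftrightarrow>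
     (\<forall>X. finite X \<longrightarrow> (\<exists>B. subalgebra B \<and> finite_dim B \<and> X \<subseteq> B))"

text \<open>
  A local system is represented by the set of its members. Repetitions in an indexed family are
  immaterial to the defining conditions, so this is no restriction.
\<close>

definition local_system :: "'a set set \<Rightarrow> bool" where
  "local_system L \<longleftrightarrow>
     (\<forall>B\<in>L. subalgebra B \<and> finite_dim B) \<and>
     \<Union>L = UNIV \<and>
     (\<forall>B\<in>L. \<forall>C\<in>L. \<exists>D\<in>L. B \<subseteq> D \<and> C \<subseteq> D)"

definition perfect :: "'a set \<Rightarrow> bool" where
  "perfect B \<longleftrightarrow> span {x * y | x y. x \<in> B \<and> y \<in> B} = B"

definition perfect_local_system :: "'a set set \<Rightarrow> bool" where
  "perfect_local_system L \<longleftrightarrow> local_system L \<and> (\<forall>B\<in>L. perfect B)"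

end

end

(*
  For a finite dimensional subalgebra B let P(B) be the last term of its derived series. Then
  P(B) is a perfect ideal of B, and P(B) is monotone in B, so the union I of all P(B) is an ideal
  of A. By simplicity I = 0 or I = A. If I = A, then every finite subset of A lies in some P(B),
  and the finite dimensional perfect subalgebras form a local system. If I = 0, every finite
  dimensional subalgebra is solvable; but simplicity gives AxA = A for any x \<noteq> 0, whence x lies in
  span(BxB) for some finite dimensional subalgebra B, and substituting this expression for x into
  itself repeatedly puts x into span(DxD) for every term D of the derived series, so x = 0.
*)

theory Submission
  imports Defs
begin

context assoc_algebra
begin

section \<open>Products of spans and finite dimensional subspaces\<close>

lemma span_mult_subset:
  assumes "subspace T" and "\<And>x y. x \<in> X \<Longrightarrow> y \<in> Y \<Longrightarrow> x * y \<in> T"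
    and "x \<in> span X" and "y \<in> span Y"
  shows "x * y \<in> T"
proof -
  have 1: "x * y \<in> T" if "x \<in> X" for x
    using \<open>y \<in> span Y\<close>
  proof (induction rule: span_induct)
    case base
    show ?case
      using assms(1) by (auto simp: subspace_def distrib_left scale_mult_right)
  next
    case (step y)
    then show ?case using assms(2) that by simp
  qed
  show ?thesis
    using \<open>x \<in> span X\<close>
  proof (induction rule: span_induct)
    case base
    show ?case
      using assms(1) by (auto simp: subspace_def distrib_right scale_mult_left)
  next
    case (step x)
    then show ?case using 1 by simp
  qed
qed

lemma subspace_finite_basis:
  assumes "subspace S" and "S \<subseteq> span B" and "finite B"
  obtains C where "C \<subseteq> S" "finite C" "independent C" "span C = S" "card C = dim S"
proof -
  obtain C where C: "C \<subseteq> S" "independent C" "S \<subseteq> span C" "card C = dim S"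
    using basis_exists by blast
  moreover have "finite C"
    using independent_span_bound[OF \<open>finite B\<close> C(2)] C(1) assms(2) by blast
  moreover have "span C = S"
    using C(1,3) span_minimal[OF C(1) assms(1)] by blast
  ultimately show thesis using that by blast
qed

lemma finite_dim_subspace:
  assumes "finite_dim T" and "subspace S" and "S \<subseteq> T"
  shows "finite_dim S"
proof -
  obtain B where "finite B" "T = span B" using assms(1) by (auto simp: finite_dim_def)
  then obtain C where "finite C" "span C = S"
    using subspace_finite_basis[OF assms(2)] assms(3) by metis
  then show ?thesis unfolding finite_dim_def by blast
qed

text \<open>A vector of \<open>T\<close> outside \<open>S\<close> would enlarge a basis of
  \<open>S\<close> to an independent set with more elements than a finite basis of
  \<open>T\<close>.\<close>

lemma subspace_eq_if_dim_le:
  assumes "finite_dim T" "subspace T" "subspace S" "S \<subseteq> T" "dim T \<le> dim S"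
  shows "S = T"
proof (rule ccontr)
  assume "S \<noteq> T"
  then obtain x where x: "x \<in> T" "x \<notin> S" using assms(4) by blast
  obtain B where B: "finite B" "T = span B" using assms(1) by (auto simp: finite_dim_def)
  obtain s where s: "s \<subseteq> S" "finite s" "independent s" "span s = S" "card s = dim S"
    by (rule subspace_finite_basis[OF assms(3) _ B(1)]) (use assms(4) B(2) in auto)
  obtain t where t: "finite t" "span t = T" "card t = dim T"
    by (rule subspace_finite_basis[OF assms(2) _ B(1)]) (use B(2) in auto)
  have "independent (insert x s)"
    using s x independent_insertI by blast
  moreover have "insert x s \<subseteq> span t"
    using s(1) x(1) assms(4) t(2) by blast
  ultimately have "card (insert x s) \<le> card t"
    using independent_span_bound[OF t(1)] by blast
  moreover have "x \<notin> s" using s(1) x(2) by blast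
  ultimately show False using s t assms(5) by simp
qed

section \<open>The derived series and its stable term\<close>

primrec derived :: "'a set \<Rightarrow> nat \<Rightarrow> 'a set" where
  "derived B 0 = B"
| "derived B (Suc n) = span {x * y | x y. x \<in> derived B n \<and> y \<in> derived B n}"

text \<open>The intersection avoids choosing an index at which the series stabilises, which makes
  monotonicity in \<open>B\<close> immediate. For a finite dimensional subalgebra it is the stable
  term of the series.\<close>

definition perfect_core :: "'a set \<Rightarrow> 'a set" where
  "perfect_core B = (\<Inter>n. derived B n)"

lemma mult_in_derived_Suc:
  "x \<in> derived B n \<Longrightarrow> y \<in> derived B n \<Longrightarrow> x * y \<in> derived B (Suc n)"
  by (auto intro: span_base)

lemma derived_mono: "B \<subseteq> C \<Longrightarrow> derived B n \<subseteq> derived C n"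
proof (induction n)
  case (Suc n)
  then show ?case unfolding derived.simps(2) by (intro span_mono) blast
qed simp

lemma perfect_core_mono: "B \<subseteq> C \<Longrightarrow> perfect_core B \<subseteq> perfect_core C"
  unfolding perfect_core_def by (intro INF_mono') (rule derived_mono)

lemma subspace_derived: "subalgebra B \<Longrightarrow> subspace (derived B n)"
  by (cases n) (auto simp: subalgebra_def)

text \<open>By associativity b(xy) = (bx)y and (xy)b = x(yb), so a multiplier from \<open>B\<close>
  is absorbed by one factor of a product, where the induction hypothesis applies.\<close>

lemma derived_ideal:
  assumes "subalgebra B" "x \<in> derived B n" "b \<in> B"
  shows "b * x \<in> derived B n" "x * b \<in> derived B n"
proof -
  have "b * x \<in> derived B n \<and> x * b \<in> derived B n"
    using assms(2)
  proof (induction n arbitrary: x)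
    case 0
    then show ?case using assms by (auto simp: subalgebra_def)
  next
    case (Suc n)
    have sub: "subspace (derived B (Suc n))" by simp
    from Suc.prems show ?case
      unfolding derived.simps(2)
    proof (induction rule: span_induct)
      case base
      show ?case
        using sub unfolding derived.simps(2)
        by (auto simp: subspace_def distrib_left distrib_right scale_mult_left scale_mult_right)
    next
      case (step z)
      then obtain x y where z: "z = x * y" and xy: "x \<in> derived B n" "y \<in> derived B n"
        by blast
      have "(b * x) * y \<in> derived B (Suc n)" "x * (y * b) \<in> derived B (Suc n)"
        using Suc.IH xy mult_in_derived_Suc by blast+
      then show ?case by (simp add: z mult.assoc)
    qed
  qed
  then show "b * x \<in> derived B n" "x * b \<in> derived B n" by blast+
qed

lemma derived_subset:
  assumes "subalgebra B"
  shows "derived B n \<subseteq> B"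
proof (induction n)
  case (Suc n)
  have "subspace B" "\<And>x y. x \<in> B \<Longrightarrow> y \<in> B \<Longrightarrow> x * y \<in> B"
    using assms by (auto simp: subalgebra_def)
  then show ?case
    unfolding derived.simps(2) using Suc by (intro span_minimal) blast+
qed simp

lemma derived_Suc_subset:
  assumes "subalgebra B"
  shows "derived B (Suc n) \<subseteq> derived B n"
  unfolding derived.simps(2)
proof (rule span_minimal[OF _ subspace_derived[OF assms]])
  \<comment> \<open>Regarding the right factor merely as an element of \<open>B\<close> lets the
    ideal property apply.\<close>
  show "{x * y |x y. x \<in> derived B n \<and> y \<in> derived B n} \<subseteq> derived B n"
    using derived_subset[OF assms, of n] derived_ideal(2)[OF assms] by blast
qed

lemma derived_stationary:
  assumes "subalgebra B" "finite_dim B"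
  obtains n where "derived B (Suc n) = derived B n" "perfect_core B = derived B n"
proof -
  \<comment> \<open>Dimensions are natural numbers, so some term has minimal dimension; the next
    term, contained in it, cannot be smaller.\<close>
  define n where "n = arg_min (\<lambda>n. dim (derived B n)) (\<lambda>_. True)"
  have "dim (derived B n) \<le> dim (derived B (Suc n))"
    unfolding n_def by (rule arg_min_nat_le) simp
  moreover have "finite_dim (derived B n)"
    by (rule finite_dim_subspace[OF assms(2) subspace_derived derived_subset]) (fact assms(1))+
  ultimately have stat: "derived B (Suc n) = derived B n"
    by (intro subspace_eq_if_dim_le subspace_derived derived_Suc_subset assms(1))
  \<comment> \<open>Each term determines the next, so a single repetition makes the series constant
    from \<open>n\<close> on.\<close>
  have const: "derived B (n + k) = derived B n" for k
  proof (induction k)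
    case (Suc k)
    have "derived B (n + Suc k) = derived B (Suc n)"
      using Suc.IH by simp
    then show ?case using stat by (rule trans)
  qed simp
  have "derived B n \<subseteq> derived B m" for m
  proof (cases "n \<le> m")
    case True
    then show ?thesis using const[of "m - n"] by simp
  next
    case False
    then have "n \<ge> m" by simp
    then show ?thesis
      by (rule lift_Suc_antimono_le[of "derived B", rotated]) (rule derived_Suc_subset[OF assms(1)])
  qed
  then have "perfect_core B = derived B n"
    unfolding perfect_core_def by blast
  with stat show thesis by (rule that)
qed

text \<open>At an index where the series repeats, the equality of the two consecutive terms is
  exactly perfectness of the core.\<close>

lemma perfect_core_props:
  assumes "subalgebra B" "finite_dim B"
  shows "subalgebra (perfect_core B)" "finite_dim (perfect_core B)" "perfect (perfect_core B)"
proof -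
  obtain n where n: "derived B (Suc n) = derived B n" "perfect_core B = derived B n"
    using derived_stationary[OF assms] .
  show "subalgebra (perfect_core B)"
    using subspace_derived[OF assms(1), of n] mult_in_derived_Suc[of _ B n]
    unfolding subalgebra_def n by blast
  show "finite_dim (perfect_core B)"
    unfolding n(2)
    by (rule finite_dim_subspace[OF assms(2) subspace_derived derived_subset]) (fact assms(1))+
  show "perfect (perfect_core B)"
    using n(1) unfolding perfect_def n(2) by simp
qed

lemma perfect_core_ideal:
  assumes "subalgebra B" "x \<in> perfect_core B" "b \<in> B"
  shows "b * x \<in> perfect_core B" "x * b \<in> perfect_core B"
  using assms(2) unfolding perfect_core_def
  by (auto intro: derived_ideal[OF assms(1) _ assms(3)])

section \<open>Directedness and the union of the perfect cores\<close>

lemma finite_dim_subalgebra_cover: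
  assumes "locally_finite_algebra" "finite \<B>" "\<And>B. B \<in> \<B> \<Longrightarrow> finite_dim B"
  obtains C where "subalgebra C" "finite_dim C" "\<And>B. B \<in> \<B> \<Longrightarrow> B \<subseteq> C"
proof -
  have "\<forall>B\<in>\<B>. \<exists>X. finite X \<and> B = span X"
    using assms(3) by (auto simp: finite_dim_def)
  then obtain g where g: "\<And>B. B \<in> \<B> \<Longrightarrow> finite (g B) \<and> B = span (g B)"
    by metis
  \<comment> \<open>Local finiteness speaks of finite sets, so it is applied to the union of finite
    spanning sets; a subalgebra containing these contains their spans.\<close>
  then have "finite (\<Union>(g ` \<B>))" using assms(2) by blast
  then obtain C where C: "subalgebra C" "finite_dim C" "\<Union>(g ` \<B>) \<subseteq> C"
    using assms(1) unfolding locally_finite_algebra_def by blast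
  have "B \<subseteq> C" if "B \<in> \<B>" for B
  proof -
    have "g B \<subseteq> C" using C(3) that by blast
    then have "span (g B) \<subseteq> C"
      using C(1) by (intro span_minimal) (auto simp: subalgebra_def)
    then show ?thesis using g[OF that] by simp
  qed
  with C(1,2) show thesis by (rule that)
qed

text \<open>By monotonicity two cores lie in the core of a common larger subalgebra, which can also
  be made to contain a given multiplier; closure is then checked inside a single core.\<close>

lemma ideal_Union_perfect_core:
  assumes "locally_finite_algebra"
  shows "ideal {x. \<exists>B. subalgebra B \<and> finite_dim B \<and> x \<in> perfect_core B}" (is "ideal ?I")
proof -
  have cover: "\<exists>D. subalgebra D \<and> finite_dim D \<and> B \<subseteq> D \<and> C \<subseteq> D"
    if "finite_dim B" "finite_dim C" for B C
    by (rule finite_dim_subalgebra_cover[OF assms, of "{B, C}"]) (use that in auto)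
  have sub: "subspace (perfect_core B)" if "subalgebra B" "finite_dim B" for B
    using perfect_core_props(1)[OF that] by (simp add: subalgebra_def)
  have zero: "0 \<in> ?I"
    using assms sub unfolding locally_finite_algebra_def
    by (blast intro: subspace_0)
  have add: "x + y \<in> ?I" if xy: "x \<in> ?I" "y \<in> ?I" for x y
  proof -
    obtain B C where B: "finite_dim B" "x \<in> perfect_core B"
      and C: "finite_dim C" "y \<in> perfect_core C"
      using xy by blast
    obtain D where D: "subalgebra D" "finite_dim D" "B \<subseteq> D" "C \<subseteq> D"
      using cover B(1) C(1) by blast
    then have "x \<in> perfect_core D" "y \<in> perfect_core D"
      using perfect_core_mono B C by blast+
    then show ?thesis using subspace_add[OF sub] D by blast
  qed
  have scale: "scale c x \<in> ?I" if "x \<in> ?I" for c x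
    using that sub subspace_scale by blast
  have mult: "a * x \<in> ?I \<and> x * a \<in> ?I" if x: "x \<in> ?I" for a x
  proof -
    obtain B where B: "finite_dim B" "x \<in> perfect_core B" using x by blast
    \<comment> \<open>\<open>cover\<close> takes finite dimensional subspaces, so the multiplier
      \<open>a\<close> enters through its span.\<close>
    have "finite_dim (span {a})" by (auto simp: finite_dim_def)
    then obtain D where D: "subalgebra D" "finite_dim D" "B \<subseteq> D" "span {a} \<subseteq> D"
      using cover B(1) by blast
    have "a \<in> D" using D(4) span_base[of a "{a}"] by blast
    moreover have "x \<in> perfect_core D" using perfect_core_mono B D by blast
    ultimately show ?thesis using perfect_core_ideal D by blast
  qed
  show ?thesis
    unfolding ideal_def subspace_def
    by (intro conjI ballI allI zero add scale mult[THEN conjunct1] mult[THEN conjunct2])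
qed

section \<open>Simplicity and sandwiches axb\<close>

lemma ideal_spanI:
  assumes "\<And>a x. x \<in> X \<Longrightarrow> a * x \<in> span X \<and> x * a \<in> span X"
  shows "ideal (span X)"
  unfolding ideal_def
proof (intro conjI ballI allI)
  fix x a assume x: "x \<in> span X"
  have a: "a \<in> span {a}" by (rule span_base) (rule singletonI)
  show "a * x \<in> span X"
    by (rule span_mult_subset[OF subspace_span _ a x]) (use assms in simp)
  show "x * a \<in> span X"
    by (rule span_mult_subset[OF subspace_span _ x a]) (use assms in simp)
qed (rule subspace_span)

text \<open>Both AA and AxA span ideals, and AA = A since it contains a nonzero product. If AxA were
  zero, x would lie in the ideal of all y with AyA = 0, which would then be A; now AAA = 0 and AA =
  A give AA = 0, a contradiction.\<close>

lemma simple_algebra_sandwich: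
  assumes "simple_algebra" "x \<noteq> 0"
  shows "span {a * x * b | a b. True} = UNIV"
proof -
  from assms(1) obtain u v :: 'a where uv: "u * v \<noteq> 0"
    and simple: "\<And>I. ideal I \<Longrightarrow> I = {0} \<or> I = UNIV"
    unfolding simple_algebra_def by blast
  have "ideal (span {a * b | a b :: 'a. True})" (is "ideal (span ?P)")
  proof (rule ideal_spanI)
    fix a x assume "x \<in> ?P"
    show "a * x \<in> span ?P \<and> x * a \<in> span ?P" by (auto intro: span_base)
  qed
  moreover have "u * v \<in> span ?P" by (auto intro: span_base)
  ultimately have P: "span ?P = UNIV" using simple uv by blast
  have "ideal (span {a * x * b | a b. True})" (is "ideal (span ?S)")
  proof (rule ideal_spanI)
    fix c y assume "y \<in> ?S"
    then obtain a b where y: "y = a * x * b" by blast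
    have "c * y = (c * a) * x * b" "y * c = a * x * (b * c)"
      by (simp_all add: y mult.assoc)
    then have "c * y \<in> ?S" "y * c \<in> ?S" by blast+
    then show "c * y \<in> span ?S \<and> y * c \<in> span ?S" by (auto intro: span_base)
  qed
  then consider "span ?S = {0}" | "span ?S = UNIV" using simple by blast
  then show ?thesis
  proof cases
    case 1
    let ?Z = "{y :: 'a. \<forall>a b. a * y * b = 0}"
    have "a * x * b = 0" for a b
      using 1 span_base[of "a * x * b" ?S] by blast
    then have "x \<in> ?Z" by blast
    moreover have "ideal ?Z"
      unfolding ideal_def subspace_def
    proof (intro conjI ballI allI)
      fix y c assume y: "y \<in> ?Z"
      have "a * (c * y) * b = (a * c) * y * b" "a * (y * c) * b = a * y * (c * b)" for a b
        by (simp_all add: mult.assoc)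
      then show "c * y \<in> ?Z" "y * c \<in> ?Z" using y by simp_all
    qed (auto simp: distrib_left distrib_right scale_mult_left scale_mult_right)
    ultimately have Z: "?Z = UNIV" using simple assms(2) by blast
    \<comment> \<open>\<open>u\<close> is a combination of products ab, and (ab)v = 0 because b lies
      in \<open>?Z\<close>.\<close>
    have "u * v \<in> {0}"
    proof (rule span_mult_subset)
      show "u \<in> span ?P" using P by blast
      show "v \<in> span {v}" by (rule span_base) (rule singletonI)
      show "x * y \<in> {0}" if "x \<in> ?P" for x y
        using that Z by blast
    qed simp
    then show ?thesis using uv by simp
  qed
qed

lemma subspace_sandwich_vimage:
  "subspace T \<Longrightarrow> subspace {y. a * y * b \<in> T}"
  by (simp add: subspace_def distrib_left distrib_right scale_mult_left scale_mult_right)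

text \<open>Replacing the inner x of axb by cxd gives (ac)x(db), whose outer factors lie one step
  further down the derived series.\<close>

lemma sandwich_derived:
  assumes "x \<in> span {a * x * b | a b. a \<in> B \<and> b \<in> B}"
  shows "x \<in> span {a * x * b | a b. a \<in> derived B n \<and> b \<in> derived B n}"
proof (induction n)
  case 0
  then show ?case using assms by simp
next
  case (Suc n)
  let ?S = "\<lambda>n. {a * x * b | a b. a \<in> derived B n \<and> b \<in> derived B n}"
  have *: "a * z * b \<in> span (?S (Suc n))"
    if ab: "a \<in> derived B n" "b \<in> derived B n" and "z \<in> span (?S n)" for a b z
    using that(3)
  proof (induction rule: span_induct)
    case base
    show ?case by (rule subspace_sandwich_vimage) (rule subspace_span)
  next
    case (step y)
    then obtain c d where y: "y = c * x * d" and cd: "c \<in> derived B n" "d \<in> derived B n"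
      by blast
    have "a * y * b = (a * c) * x * (d * b)" by (simp add: y mult.assoc)
    moreover have "a * c \<in> derived B (Suc n)" "d * b \<in> derived B (Suc n)"
      using mult_in_derived_Suc ab cd by blast+
    ultimately have "a * y * b \<in> ?S (Suc n)" by blast
    then show ?case by (rule span_base)
  qed
  \<comment> \<open>The case \<open>z = x\<close> of \<open>*\<close>, available by the induction
    hypothesis, substitutes the expression for \<open>x\<close> into itself.\<close>
  have "?S n \<subseteq> span (?S (Suc n))"
    using *[OF _ _ Suc.IH] by blast
  then have "span (?S n) \<subseteq> span (?S (Suc n))"
    by (rule span_minimal) (rule subspace_span)
  then show ?case using Suc.IH by blast
qed

lemma exists_perfect_core_nonzero:
  assumes "simple_algebra" "locally_finite_algebra"
  obtains B z where "subalgebra B" "finite_dim B" "z \<in> perfect_core B" "z \<noteq> 0"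
proof -
  obtain x :: 'a where x: "x \<noteq> 0"
    using assms(1) unfolding simple_algebra_def by (metis mult_zero_left)
  have "x \<in> span {a * x * b | a b. True}"
    using simple_algebra_sandwich[OF assms(1) x] by simp
  then obtain t r where t: "finite t" "t \<subseteq> {a * x * b | a b. True}"
    "x = (\<Sum>y\<in>t. scale (r y) y)"
    unfolding span_explicit by blast
  have "\<forall>y\<in>t. \<exists>a b. y = a * x * b" using t(2) by blast
  then obtain f g where fg: "\<And>y. y \<in> t \<Longrightarrow> y = f y * x * g y" by metis
  \<comment> \<open>Only finitely many outer factors occur in the combination for \<open>x\<close>,
    so local finiteness puts them all into one \<open>B\<close>.\<close>
  obtain B where B: "subalgebra B" "finite_dim B" "f ` t \<union> g ` t \<subseteq> B"
    using assms(2) t(1) unfolding locally_finite_algebra_def by (metis finite_UnI finite_imageI)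
  have "t \<subseteq> {a * x * b | a b. a \<in> B \<and> b \<in> B}"
    using fg B(3) by blast
  then have "x \<in> span {a * x * b | a b. a \<in> B \<and> b \<in> B}"
    by (subst t(3)) (intro span_sum span_scale span_base, blast)
  then have *: "x \<in> span {a * x * b | a b. a \<in> derived B n \<and> b \<in> derived B n}" for n
    by (rule sandwich_derived)
  obtain n where n: "perfect_core B = derived B n"
    using derived_stationary[OF B(1,2)] by blast
  \<comment> \<open>With a zero core, all sandwiches at the stable index \<open>n\<close> would
    vanish, although \<open>x\<close> lies in their span.\<close>
  have "\<not> perfect_core B \<subseteq> {0}"
  proof
    assume "perfect_core B \<subseteq> {0}"
    then have "{a * x * b | a b. a \<in> derived B n \<and> b \<in> derived B n} \<subseteq> {0}"
      using n by auto
    then have "x \<in> {0}" using *[of n] span_minimal[OF _ subspace_single_0] by blast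
    then show False using x by simp
  qed
  then show thesis using that B by blast
qed

section \<open>Assembling the local system\<close>

lemma finite_subset_perfect_core:
  assumes "simple_algebra" "locally_finite_algebra" "finite X"
  obtains B where "subalgebra B" "finite_dim B" "X \<subseteq> perfect_core B"
proof -
  let ?I = "{x. \<exists>B. subalgebra B \<and> finite_dim B \<and> x \<in> perfect_core B}"
  have "?I = {0} \<or> ?I = UNIV"
    using ideal_Union_perfect_core[OF assms(2)] assms(1) unfolding simple_algebra_def by meson
  moreover obtain B z where "subalgebra B" "finite_dim B" "z \<in> perfect_core B" "z \<noteq> 0"
    using exists_perfect_core_nonzero[OF assms(1,2)] .
  then have "z \<in> ?I" "z \<noteq> 0" by blast+
  ultimately have "?I = UNIV" by blast
  then have "\<forall>x. \<exists>B. subalgebra B \<and> finite_dim B \<and> x \<in> perfect_core B" by blast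
  then obtain h where h: "\<And>x. subalgebra (h x) \<and> finite_dim (h x) \<and> x \<in> perfect_core (h x)"
    by metis
  \<comment> \<open>One \<open>C\<close> containing the finitely many \<open>h x\<close> serves all
    of \<open>X\<close>, by monotonicity of the core.\<close>
  have "finite (h ` X)" and "\<And>B. B \<in> h ` X \<Longrightarrow> finite_dim B"
    using h assms(3) by blast+
  then obtain C where C: "subalgebra C" "finite_dim C" "\<And>B. B \<in> h ` X \<Longrightarrow> B \<subseteq> C"
    using finite_dim_subalgebra_cover[OF assms(2)] by metis
  have "X \<subseteq> perfect_core C"
  proof
    fix x assume "x \<in> X"
    then have "h x \<subseteq> C" using C(3) by blast
    then show "x \<in> perfect_core C" using h perfect_core_mono by blast
  qed
  with C(1,2) show thesis by (rule that)
qed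

lemma perfect_local_system_perfect_subalgebras:
  assumes "simple_algebra" "locally_finite_algebra"
  shows "perfect_local_system {B. subalgebra B \<and> finite_dim B \<and> perfect B}"
    (is "perfect_local_system ?L")
proof -
  have ex: "\<exists>B\<in>?L. X \<subseteq> B" if X: "finite X" for X
  proof -
    obtain B where "subalgebra B" "finite_dim B" "X \<subseteq> perfect_core B"
      using finite_subset_perfect_core[OF assms X] .
    then show ?thesis using perfect_core_props by blast
  qed
  have "x \<in> \<Union>?L" for x using ex[of "{x}"] by auto
  moreover have "\<exists>D\<in>?L. B \<subseteq> D \<and> C \<subseteq> D" if BC: "B \<in> ?L" "C \<in> ?L" for B C
  proof -
    \<comment> \<open>Directedness reduces to \<open>ex\<close> for a finite set: a member
      containing both spanning sets contains \<open>B\<close> and \<open>C\<close>.\<close>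
    obtain b c where bc: "finite b" "B = span b" "finite c" "C = span c"
      using BC by (auto simp: finite_dim_def)
    then obtain D where D: "D \<in> ?L" "b \<union> c \<subseteq> D" using ex[of "b \<union> c"] by auto
    then have "subspace D" by (simp add: subalgebra_def)
    then have "B \<subseteq> D" "C \<subseteq> D" using D(2) bc span_minimal by auto
    then show ?thesis using D(1) by blast
  qed
  ultimately show ?thesis
    unfolding perfect_local_system_def local_system_def by blast
qed

end

theorem theorem4p1:
  fixes scale :: "'k::alg_closed_field \<Rightarrow> 'a::ring \<Rightarrow> 'a"
  assumes "assoc_algebra scale"
    and "assoc_algebra.countably_infinite_dim scale UNIV"
    and "assoc_algebra.simple_algebra scale"
    and "assoc_algebra.locally_finite_algebra scale"
  shows "\<exists>L. assoc_algebra.perfect_local_system scale L"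
  using assoc_algebra.perfect_local_system_perfect_subalgebras[OF assms(1,3,4)] by blast

end
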